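(* Let $n \in \mathbb{N}$ with $n>1$, let $x_1,\dots,x_n$ be commuting indeterminates over $\mathbb{C}$, and let $\varepsilon_k^{1,\dots,n}$ ($k=1,\dots,n$) be the elementary symmetric polynomials in $x_1,\dots,x_n$. Then for any fixed $i_0 \in \{1,\dots,n\}$, $$\varepsilon_k^{1,\dots,n} = \varepsilon_k^{1,\dots,i_0-1,\,i_0+1,\dots,n} + \varepsilon_{k-1}^{1,\dots,i_0-1,\,i_0+1,\dots,n}\,\varepsilon_1^{i_0}$$ for all $k=1,2,\dots,n$.
   Context: For distinct indices $i_1,\dots,i_t \in \{1,\dots,n\}$ and $1\le k \le t$, $\varepsilon_k^{i_1,\dots,i_t}$ denotes the $k$-th elementary symmetric polynomial in the variables $x_{i_1},\dots,x_{i_t}$, i.e. the sum of all products of $k$ of these variables with distinct indices. By convention $\varepsilon_0^{i_1,\dots,i_t}=1$ and $\varepsilon_k^{i_1,\dots,i_t}=0$ for $k>t$. In particular $\varepsilon_1^{i_0}=x_{i_0}$. *)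

theory Defs
  imports Complex_Main "HOL-Library.Poly_Mapping"
begin

text \<open>
  Polynomials over the complex numbers in indeterminates indexed by the natural numbers:
  an exponent vector is a finitely supported function from variable indices to exponents, and a
  polynomial is a finitely supported function from exponent vectors to coefficients, multiplied by
  convolution. For every \<open>n\<close> this ring contains the polynomial ring in the indeterminates
  with indices \<open>1, \<dots>, n\<close> as a subring.
\<close>

type_synonym cpoly = "(nat \<Rightarrow>\<^sub>0 nat) \<Rightarrow>\<^sub>0 complex"

definition Var :: "nat \<Rightarrow> cpoly" where
  "Var i = Poly_Mapping.single (Poly_Mapping.single i 1) 1"

text \<open>
  Since the indices are distinct and the order of the variables is irrelevant, the index list
  \<open>i\<^sub>1, \<dots>, i\<^sub>t\<close> is represented by the finite set \<open>I\<close> of its entries. The conventions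
  for \<open>k = 0\<close> and \<open>k > t\<close> follow from the formula; see the lemmas below.
\<close>

definition esym :: "nat \<Rightarrow> nat set \<Rightarrow> cpoly" where
  "esym k I = (\<Sum>J | J \<subseteq> I \<and> card J = k. \<Prod>j\<in>J. Var j)"

lemma esym_0:
  assumes "finite I"
  shows "esym 0 I = 1"
proof -
  have "{J. J \<subseteq> I \<and> card J = 0} = {{}}"
    using assms by (auto dest: finite_subset)
  then show ?thesis
    by (simp add: esym_def)
qed

lemma esym_eq_0:
  assumes "finite I" and "k > card I"
  shows "esym k I = 0"
proof -
  have "{J. J \<subseteq> I \<and> card J = k} = {}"
    using assms by (auto dest: card_mono)
  then show ?thesis
    by (simp only: esym_def sum.empty)
qed

lemma esym_1_singleton: "esym 1 {i} = Var i"
proof -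
  have "{J. J \<subseteq> {i} \<and> card J = 1} = {{i}}"
    by (auto simp: card_1_singleton_iff)
  then show ?thesis
    by (simp add: esym_def)
qed

end

theory Submission
  imports Defs
begin

text \<open>Sort the monomials of the left-hand side by whether they involve the variable with index
  \<open>i0\<close>. Those that do not are the degree-\<open>k\<close> squarefree monomials in the
  other variables; those that do are \<open>Var i0\<close> times such a monomial of degree
  \<open>k - 1\<close>. \<open>Collect_subset_insert_card\<close> is this split on the level of
  index sets, and \<open>esym_insert\<close> carries it over to the sums.\<close>

lemma Collect_subset_insert_card:
  assumes "finite A" and "a \<notin> A"
  shows "{J. J \<subseteq> insert a A \<and> card J = Suc k} =
    {J. J \<subseteq> A \<and> card J = Suc k} \<union> insert a ` {J. J \<subseteq> A \<and> card J = k}"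
    (is "?L = ?S \<union> ?T")
proof (intro equalityI subsetI)
  fix J assume J: "J \<in> ?L"
  show "J \<in> ?S \<union> ?T"
  proof (cases "a \<in> J")
    case True
    then have "J = insert a (J - {a})" and "J - {a} \<subseteq> A" and "card (J - {a}) = k"
      using J by auto
    then show ?thesis by blast
  next
    case False
    with J show ?thesis by auto
  qed
next
  fix J assume "J \<in> ?S \<union> ?T"
  \<comment> \<open>Finiteness of \<open>A\<close> enters here: \<open>card\<close> is 0 on infinite
    sets, so an insertion would not raise it.\<close>
  moreover have "card (insert a K) = Suc (card K)" if "K \<subseteq> A" for K
    using assms that by (meson card_insert_disjoint finite_subset subsetD)
  ultimately show "J \<in> ?L" by auto
qed

lemma esym_insert:
  assumes "finite A" and "a \<notin> A"
  shows "esym (Suc k) (insert a A) = esym (Suc k) A + esym k A * Var a"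
proof -
  let ?S = "\<lambda>k. {J. J \<subseteq> A \<and> card J = k}"
  have fin: "finite (?S k)" for k
    using assms(1) by simp
  \<comment> \<open>No member of the family contains \<open>a\<close>, so deleting \<open>a\<close>
    recovers it; this justifies the reindexing of the sum below.\<close>
  have inj: "inj_on (insert a) (?S k)"
    using assms(2) by (auto simp: inj_on_def insert_eq_iff dest: subsetD)
  have "(\<Prod>j\<in>insert a J. Var j) = (\<Prod>j\<in>J. Var j) * Var a" if "J \<in> ?S k" for J
  proof -
    have "finite J" and "a \<notin> J"
      using that assms finite_subset by auto
    then show ?thesis by (simp add: mult.commute)
  qed
  then have "(\<Sum>J\<in>insert a ` ?S k. \<Prod>j\<in>J. Var j) = esym k A * Var a"
    by (simp add: sum.reindex[OF inj] esym_def sum_distrib_right)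
  \<comment> \<open>Only the sets of the second family contain \<open>a\<close>, so the sum over the
    union splits.\<close>
  moreover have "?S (Suc k) \<inter> insert a ` ?S k = {}"
    using assms(2) by auto
  ultimately show ?thesis
    using fin unfolding esym_def[of "Suc k"] Collect_subset_insert_card[OF assms]
    by (subst sum.union_disjoint) auto
qed

theorem theorem2p2:
  fixes n i0 :: nat
  assumes "n > 1" and "i0 \<in> {1..n}"
  shows "\<forall>k\<in>{1..n}.
    esym k {1..n} = esym k ({1..n} - {i0}) + esym (k - 1) ({1..n} - {i0}) * esym 1 {i0}"
proof
  fix k assume "k \<in> {1..n}"
  \<comment> \<open>Truncated subtraction is harmless since \<open>k\<close> is at least 1.\<close>
  then have "k = Suc (k - 1)"
    by simp
  moreover have "{1..n} = insert i0 ({1..n} - {i0})"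
    using assms(2) by auto
  ultimately show "esym k {1..n} =
      esym k ({1..n} - {i0}) + esym (k - 1) ({1..n} - {i0}) * esym 1 {i0}"
    using esym_insert[of "{1..n} - {i0}" i0 "k - 1"] by (simp only: esym_1_singleton) simp
qed

end
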